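(* There exists a sentence $\theta$ of the logic ${\cal R}ing(0,+,*,<)+MOD+M$ such that its prime spectrum $Sp(\theta)$ has no exponential density, i.e. the limit $\lim_{n\to\infty}\log(\pi_{Sp(\theta)}(n))/\log(\pi(n))$ does not exist.
   Context: For an integer $m\ge 1$, $\mathbb{Z}_m$ denotes the finite residue class ring with universe $\{0,1,\ldots,m-1\}$, addition and multiplication modulo $m$. The logic ${\cal R}ing(0,+,*,<)$ consists of first-order formulas over a constant symbol $0$, binary function symbols $+,*$ and a binary relation symbol $<$; its models are the rings $\mathbb{Z}_m$, with $0$ the residue class $0$, $+,*$ addition and multiplication mod $m$, and $<$ the natural order of the representatives $0<1<\cdots<m-1$. The logic ${\cal R}ing(0,+,*,<)+MOD+M$ is the smallest extension of it closed under the usual first-order constructions and additionally under: (i) modular quantifiers $\exists^{(r,q)}z$ for all integers $q>0$ and $0\le r<q$, where $\mathbb{Z}_m\models\exists^{(r,q)}z\,\phi(\bar a,z)$ iff the number of $z\in\mathbb{Z}_m$ with $\mathbb{Z}_m\models\phi(\bar a,z)$ is congruent to $r$ modulo $q$; (ii) the majority quantifier $Mz$, where $\mathbb{Z}_m\models Mz\,\phi(\bar a,z)$ iff $\phi(\bar a,z)$ holds for more than half of the elements $z\in\mathbb{Z}_m$. The prime spectrum of a sentence $\sigma$ is $Sp(\sigma)=\{p\text{ prime}:\mathbb{Z}_p\models\sigma\}$. For real $x>0$, $\pi(x)$ is the number of primes $\le x$ and, for a set $S$ of primes, $\pi_S(x)=|\{q\in S:q\le x\}|$. $S$ has exponential density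 if $\lim_{n\to\infty}\log(\pi_S(n))/\log(\pi(n))$ (over natural numbers $n$) exists. *)

theory Defs
  imports Complex_Main "HOL-Number_Theory.Residues"
begin

datatype ring_term =
    TVar nat
  | TZero
  | TAdd ring_term ring_term
  | TMul ring_term ring_term

text \<open>
  \<open>ExMod r q z \<phi>\<close> is the modular quantifier \<open>\<exists>\<^sup>(\<^sup>r\<^sup>,\<^sup>q\<^sup>) z. \<phi>\<close> and \<open>Maj z \<phi>\<close> the majority
  quantifier \<open>M z. \<phi>\<close>. The datatype also contains modular quantifiers with \<open>r \<ge> q\<close>; these are
  excluded by \<open>wf_formula\<close> below.
\<close>

datatype ring_formula =
    Eq ring_term ring_term
  | Less ring_term ring_term
  | Neg ring_formula
  | Conj ring_formula ring_formula
  | Disj ring_formula ring_formula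
  | Impl ring_formula ring_formula
  | Ex nat ring_formula
  | All nat ring_formula
  | ExMod nat nat nat ring_formula
  | Maj nat ring_formula

primrec wf_formula :: "ring_formula \<Rightarrow> bool" where
  "wf_formula (Eq s t) \<longleftrightarrow> True"
| "wf_formula (Less s t) \<longleftrightarrow> True"
| "wf_formula (Neg \<phi>) \<longleftrightarrow> wf_formula \<phi>"
| "wf_formula (Conj \<phi> \<psi>) \<longleftrightarrow> wf_formula \<phi> \<and> wf_formula \<psi>"
| "wf_formula (Disj \<phi> \<psi>) \<longleftrightarrow> wf_formula \<phi> \<and> wf_formula \<psi>"
| "wf_formula (Impl \<phi> \<psi>) \<longleftrightarrow> wf_formula \<phi> \<and> wf_formula \<psi>"
| "wf_formula (Ex z \<phi>) \<longleftrightarrow> wf_formula \<phi>"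
| "wf_formula (All z \<phi>) \<longleftrightarrow> wf_formula \<phi>"
| "wf_formula (ExMod r q z \<phi>) \<longleftrightarrow> 0 < q \<and> r < q \<and> wf_formula \<phi>"
| "wf_formula (Maj z \<phi>) \<longleftrightarrow> wf_formula \<phi>"

primrec term_vars :: "ring_term \<Rightarrow> nat set" where
  "term_vars (TVar x) = {x}"
| "term_vars TZero = {}"
| "term_vars (TAdd s t) = term_vars s \<union> term_vars t"
| "term_vars (TMul s t) = term_vars s \<union> term_vars t"

primrec free_vars :: "ring_formula \<Rightarrow> nat set" where
  "free_vars (Eq s t) = term_vars s \<union> term_vars t"
| "free_vars (Less s t) = term_vars s \<union> term_vars t"
| "free_vars (Neg \<phi>) = free_vars \<phi>"
| "free_vars (Conj \<phi> \<psi>) = free_vars \<phi> \<union> free_vars \<psi>"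
| "free_vars (Disj \<phi> \<psi>) = free_vars \<phi> \<union> free_vars \<psi>"
| "free_vars (Impl \<phi> \<psi>) = free_vars \<phi> \<union> free_vars \<psi>"
| "free_vars (Ex z \<phi>) = free_vars \<phi> - {z}"
| "free_vars (All z \<phi>) = free_vars \<phi> - {z}"
| "free_vars (ExMod r q z \<phi>) = free_vars \<phi> - {z}"
| "free_vars (Maj z \<phi>) = free_vars \<phi> - {z}"

definition ring_sentence :: "ring_formula \<Rightarrow> bool" where
  "ring_sentence \<phi> \<longleftrightarrow> wf_formula \<phi> \<and> free_vars \<phi> = {}"

primrec eval_term :: "nat \<Rightarrow> (nat \<Rightarrow> int) \<Rightarrow> ring_term \<Rightarrow> int" where
  "eval_term m e (TVar x) = e x"
| "eval_term m e TZero = \<zero>\<^bsub>residue_ring (int m)\<^esub>"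
| "eval_term m e (TAdd s t) =
     eval_term m e s \<oplus>\<^bsub>residue_ring (int m)\<^esub> eval_term m e t"
| "eval_term m e (TMul s t) =
     eval_term m e s \<otimes>\<^bsub>residue_ring (int m)\<^esub> eval_term m e t"

text \<open>
  The carrier of \<open>residue_ring (int m)\<close> is the set of integers \<open>{0..int m - 1}\<close>, so the order of
  the representatives is the order of \<open>int\<close>.
\<close>

primrec sat :: "nat \<Rightarrow> (nat \<Rightarrow> int) \<Rightarrow> ring_formula \<Rightarrow> bool" where
  "sat m e (Eq s t) \<longleftrightarrow> eval_term m e s = eval_term m e t"
| "sat m e (Less s t) \<longleftrightarrow> eval_term m e s < eval_term m e t"
| "sat m e (Neg \<phi>) \<longleftrightarrow> \<not> sat m e \<phi>"
| "sat m e (Conj \<phi> \<psi>) \<longleftrightarrow> sat m e \<phi> \<and> sat m e \<psi>"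
| "sat m e (Disj \<phi> \<psi>) \<longleftrightarrow> sat m e \<phi> \<or> sat m e \<psi>"
| "sat m e (Impl \<phi> \<psi>) \<longleftrightarrow> (sat m e \<phi> \<longrightarrow> sat m e \<psi>)"
| "sat m e (Ex z \<phi>) \<longleftrightarrow> (\<exists>a \<in> carrier (residue_ring (int m)). sat m (e(z := a)) \<phi>)"
| "sat m e (All z \<phi>) \<longleftrightarrow> (\<forall>a \<in> carrier (residue_ring (int m)). sat m (e(z := a)) \<phi>)"
| "sat m e (ExMod r q z \<phi>) \<longleftrightarrow>
     [card {a \<in> carrier (residue_ring (int m)). sat m (e(z := a)) \<phi>} = r] (mod q)"
| "sat m e (Maj z \<phi>) \<longleftrightarrow>
     2 * card {a \<in> carrier (residue_ring (int m)). sat m (e(z := a)) \<phi>}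
       > card (carrier (residue_ring (int m)))"

text \<open>For a sentence the assignment is irrelevant, so \<open>Z_models\<close> means truth in \<open>\<int>\<^sub>m\<close>.\<close>

definition Z_models :: "nat \<Rightarrow> ring_formula \<Rightarrow> bool" where
  "Z_models m \<sigma> \<longleftrightarrow> (\<forall>e. range e \<subseteq> carrier (residue_ring (int m)) \<longrightarrow> sat m e \<sigma>)"

definition prime_spectrum :: "ring_formula \<Rightarrow> nat set" where
  "prime_spectrum \<sigma> = {p. prime p \<and> Z_models p \<sigma>}"

definition count_upto :: "nat set \<Rightarrow> real \<Rightarrow> nat" where
  "count_upto S x = card {q \<in> S. real q \<le> x}"

definition prime_pi :: "real \<Rightarrow> nat" where
  "prime_pi x = count_upto {p. prime p} x"

text \<open>
  The conventions \<open>ln 0 = 0\<close> and \<open>x / 0 = 0\<close> give the empty set exponential density \<open>0\<close>, as for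
  every finite set of primes. For nonempty \<open>S\<close> they affect only finitely many terms. A set of
  primes without exponential density in this sense is therefore infinite, and its failure to
  have one is never caused by an undefined logarithm or quotient.
\<close>

definition has_exponential_density :: "nat set \<Rightarrow> bool" where
  "has_exponential_density S \<longleftrightarrow>
     (\<exists>L::real. (\<lambda>n::nat. ln (real (count_upto S (real n))) / ln (real (prime_pi (real n))))
        \<longlonglongrightarrow> L)"

end

(* Let X range over the numbers 2^(2^k). A first-order sentence can say that X^4 < m <= X^6 for some
   such X, because the elements of Z_m whose integer square is below m are definable from the order,
   and on them arithmetic modulo m is that of the integers. The prime spectrum fills the windows
   (X^4, X^6] and misses the gaps (X^6, X^8]. Counting up to X^6 the logarithmic ratio tends to 1,
   counting up to X^8 it is asymptotically at most 6/8. The only input about primes is a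
   Chebyshev-type lower bound for pi(2^m). *)
theory Submission
  imports Defs "HOL-Real_Asymp.Real_Asymp"
begin

section \<open>The formulas composing the sentence\<close>

definition Le :: "ring_term \<Rightarrow> ring_term \<Rightarrow> ring_formula" where
  "Le s t = Disj (Less s t) (Eq s t)"

text \<open>
  In the formulas below variable 0 stands for the element \<open>1\<close>, which \<open>one_form\<close> pins down as the
  least nonzero element, and the variables 10, 11, 12 are bound: term arguments must avoid them.
\<close>

text \<open>Squaring modulo \<open>m\<close> is strictly increasing on \<open>{0..t}\<close> exactly when no wrap-around occurs there,
  so \<open>small_form\<close> expresses \<open>t\<^sup>2 < m\<close> for the integer square.\<close>

definition small_form :: "ring_term \<Rightarrow> ring_formula" where
  "small_form t = All 10 (All 11 (Impl (Conj (Less (TVar 10) (TVar 11)) (Le (TVar 11) t))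
     (Less (TMul (TVar 10) (TVar 10)) (TMul (TVar 11) (TVar 11)))))"

definition one_form :: ring_formula where
  "one_form = Conj (Less TZero (TVar 0))
     (All 10 (Neg (Conj (Less TZero (TVar 10)) (Less (TVar 10) (TVar 0)))))"

definition pow2_form :: "ring_term \<Rightarrow> ring_formula" where
  "pow2_form t = All 10 (All 11 (Impl
     (Conj (Le (TVar 10) t) (Conj (Le (TVar 11) t) (Eq (TMul (TVar 10) (TVar 11)) t)))
     (Disj (Eq (TVar 10) (TVar 0))
        (Ex 12 (Conj (Less (TVar 12) (TVar 10)) (Eq (TAdd (TVar 12) (TVar 12)) (TVar 10)))))))"

text \<open>
  A power of two \<open>2\<^sup>b\<close> is of the form \<open>2 ^ 2 ^ k\<close> iff every divisor \<open>a\<close> of \<open>b\<close> is \<open>1\<close> or even.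
  Divisibility \<open>a dvd b\<close> is expressed as \<open>(2\<^sup>a - 1) dvd (2\<^sup>b - 1)\<close>, written without subtraction as
  \<open>v * w + 1 = x + w\<close>, and evenness of \<open>a\<close> as \<open>2\<^sup>a\<close> being a square.
\<close>

definition tower_form :: ring_formula where
  "tower_form = Conj (pow2_form (TVar 1)) (All 2 (Impl
     (Conj (Less (TVar 0) (TVar 2)) (Conj (Le (TVar 2) (TVar 1)) (Conj (pow2_form (TVar 2))
       (Ex 3 (Conj (Less (TVar 3) (TVar 1))
          (Eq (TAdd (TMul (TVar 2) (TVar 3)) (TVar 0)) (TAdd (TVar 1) (TVar 3))))))))
     (Disj (Eq (TVar 2) (TAdd (TVar 0) (TVar 0)))
       (Ex 3 (Conj (Less (TVar 3) (TVar 2)) (Eq (TMul (TVar 3) (TVar 3)) (TVar 2)))))))"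

definition window_sentence :: ring_formula where
  "window_sentence = Ex 0 (Conj one_form (Ex 1 (Conj (Less (TVar 0) (TVar 1))
     (Conj (small_form (TVar 1)) (Conj (small_form (TMul (TVar 1) (TVar 1)))
     (Conj (Neg (small_form (TMul (TMul (TVar 1) (TVar 1)) (TVar 1)))) tower_form))))))"

lemma ring_sentence_window: "ring_sentence window_sentence"
  unfolding ring_sentence_def window_sentence_def one_form_def small_form_def tower_form_def
    pow2_form_def Le_def
  by auto

section \<open>Truth in the residue ring as arithmetic modulo p\<close>

text \<open>\<open>small\<close>, \<open>pow2_in\<close> and \<open>tower_in\<close> mirror the
  formulas with all reductions modulo \<open>p\<close> left in place, so that passing from
  \<open>sat\<close> to them is mere unfolding; the reductions are removed later under size
  bounds.\<close>

definition small :: "int \<Rightarrow> int \<Rightarrow> bool" where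
  "small p t \<longleftrightarrow> (\<forall>a\<in>{0..p-1}. \<forall>b\<in>{0..p-1}. a < b \<and> b \<le> t \<longrightarrow> a * a mod p < b * b mod p)"

definition pow2_in :: "int \<Rightarrow> int \<Rightarrow> bool" where
  "pow2_in p v \<longleftrightarrow> (\<forall>d\<in>{0..p-1}. \<forall>e\<in>{0..p-1}. d \<le> v \<and> e \<le> v \<and> d * e mod p = v \<longrightarrow>
     d = 1 \<or> (\<exists>f\<in>{0..p-1}. f < d \<and> (f + f) mod p = d))"

definition tower_in :: "int \<Rightarrow> int \<Rightarrow> bool" where
  "tower_in p x \<longleftrightarrow> pow2_in p x \<and> (\<forall>v\<in>{0..p-1}. 1 < v \<and> v \<le> x \<and> pow2_in p v \<and>
     (\<exists>w\<in>{0..p-1}. w < x \<and> ((v * w mod p) + 1) mod p = (x + w) mod p) \<longrightarrow>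
     v = (1 + 1) mod p \<or> (\<exists>w\<in>{0..p-1}. w < v \<and> w * w mod p = v))"

lemma sat_Le [simp]: "sat m e (Le s t) \<longleftrightarrow> eval_term m e s \<le> eval_term m e t"
  by (auto simp: Le_def)

text \<open>The assumption is a semantic freshness condition: rebinding the quantified variables
  must not change the value of \<open>t\<close>.\<close>

lemma sat_small_form:
  assumes "\<And>a b. eval_term m (e(10 := a, 11 := b)) t = c"
  shows "sat m e (small_form t) \<longleftrightarrow> small (int m) c"
  by (simp add: small_form_def small_def residue_ring_def assms)

lemma sat_pow2_form:
  assumes "\<And>a b. eval_term m (e(10 := a, 11 := b)) t = c" "e 0 = 1"
  shows "sat m e (pow2_form t) \<longleftrightarrow> pow2_in (int m) c"
  by (simp add: pow2_form_def pow2_in_def residue_ring_def assms)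

lemma sat_tower_form:
  assumes "e 0 = 1"
  shows "sat m e tower_form \<longleftrightarrow> tower_in (int m) (e 1)"
  unfolding tower_form_def tower_in_def
  by (simp add: sat_pow2_form residue_ring_def assms)

lemma sat_one_form:
  assumes "m \<ge> 2" "e 0 \<in> {0..int m - 1}"
  shows "sat m e one_form \<longleftrightarrow> e 0 = 1"
proof
  assume *: "sat m e one_form"
  \<comment> \<open>The universal conjunct is instantiated with 1, which lies in the carrier because
    m \<ge> 2.\<close>
  hence "\<not> (0 < (1::int) \<and> 1 < e 0)" "0 < e 0"
    using assms by (auto simp: one_form_def residue_ring_def)
  thus "e 0 = 1" by simp
qed (auto simp: one_form_def residue_ring_def)

lemma sat_window_sentence:
  assumes "m \<ge> 2"
  defines "p \<equiv> int m"
  shows "sat m e window_sentence \<longleftrightarrow> (\<exists>x\<in>{0..p-1}. 1 < x \<and> small p x \<and>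
     small p (x * x mod p) \<and> \<not> small p ((x * x mod p) * x mod p) \<and> tower_in p x)"
proof -
  define \<psi> where "\<psi> = Ex 1 (Conj (Less (TVar 0) (TVar 1))
     (Conj (small_form (TVar 1)) (Conj (small_form (TMul (TVar 1) (TVar 1)))
     (Conj (Neg (small_form (TMul (TMul (TVar 1) (TVar 1)) (TVar 1)))) tower_form))))"
  have "sat m e window_sentence \<longleftrightarrow>
      (\<exists>u\<in>{0..int m - 1}. sat m (e(0 := u)) one_form \<and> sat m (e(0 := u)) \<psi>)"
    unfolding window_sentence_def \<psi>_def by (simp add: residue_ring_def)
  also have "\<dots> \<longleftrightarrow> (\<exists>u\<in>{0..int m - 1}. u = 1 \<and> sat m (e(0 := u)) \<psi>)"
    by (intro bex_cong refl conj_cong) (use sat_one_form[OF assms(1)] in auto)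
  also have "\<dots> \<longleftrightarrow> sat m (e(0 := 1)) \<psi>"
    using assms(1) by auto
  finally show ?thesis
    by (simp add: \<psi>_def sat_tower_form sat_small_form p_def residue_ring_def)
qed

section \<open>Eliminating wrap-around\<close>

text \<open>If t^2 \<ge> p, take the first c + 1 whose square reaches \<open>p\<close>. Since 2c + 1
  \<le> p, that square is reduced by \<open>p\<close> exactly once, and (c + 1)^2 - p \<le> c^2, so
  monotonicity fails from c to c + 1.\<close>

lemma small_iff:
  assumes "p \<ge> 2" "0 \<le> t" "t < p"
  shows "small p t \<longleftrightarrow> t * t < p"
proof
  assume t: "t * t < p"
  show "small p t"
    unfolding small_def
  proof (intro ballI impI)
    fix a b assume ab: "a \<in> {0..p - 1}" "b \<in> {0..p - 1}" "a < b \<and> b \<le> t"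
    have "b * b \<le> t * t" "a * a < b * b"
      using ab by (auto intro!: mult_mono mult_strict_mono)
    with t show "a * a mod p < b * b mod p" by simp
  qed
next
  assume s: "small p t"
  show "t * t < p"
  proof (rule ccontr)
    assume "\<not> t * t < p"
    define P where "P y \<longleftrightarrow> p \<le> int y * int y" for y
    define y where "y = (LEAST y. P y)"
    have P: "P (nat t)" using \<open>\<not> t * t < p\<close> assms by (simp add: P_def)
    hence y: "P y" "y \<le> nat t" unfolding y_def by (auto intro: LeastI Least_le)
    have "y \<noteq> 0" using y assms by (cases y) (auto simp: P_def)
    then obtain z where z: "y = Suc z" by (cases y) auto
    have "\<not> P z" using not_less_Least[of z P] z y_def by auto
    define c where "c = int z"
    have c: "c * c < p" "p \<le> (c + 1) * (c + 1)" "0 \<le> c" "c + 1 \<le> t"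
      using y \<open>\<not> P z\<close> z assms by (auto simp: P_def c_def algebra_simps)
    \<comment> \<open>For c \<ge> 2 this follows from 2c \<le> c^2 < p. The case c = 1 needs p \<ge>
      3, which comes from c + 1 \<le> t < p.\<close>
    have le: "2 * c + 1 \<le> p"
    proof (cases "c \<ge> 2")
      case True
      then have "2 * c \<le> c * c" by (intro mult_right_mono) auto
      with c(1) show ?thesis by simp
    next
      case False
      then show ?thesis using c assms by (cases "c = 0"; cases "c = 1") auto
    qed
    have "(c + 1) * (c + 1) mod p = ((c + 1) * (c + 1) - p) mod p" by simp
    also have "\<dots> = (c + 1) * (c + 1) - p"
      using c le by (intro mod_pos_pos_trivial) (auto simp: algebra_simps)
    also have "\<dots> \<le> c * c mod p" using c le by (simp add: algebra_simps)
    finally have "(c + 1) * (c + 1) mod p \<le> c * c mod p" .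
    moreover have "c * c mod p < (c + 1) * (c + 1) mod p"
      using s[unfolded small_def, rule_format, of c "c + 1"] c assms by simp
    ultimately show False by simp
  qed
qed

text \<open>The odd part of \<open>v\<close> is an odd divisor and hence must be 1.\<close>

lemma power_of_two_iff:
  fixes v :: nat
  assumes "v > 0"
  shows "(\<exists>k. v = 2 ^ k) \<longleftrightarrow> (\<forall>d. d dvd v \<longrightarrow> d = 1 \<or> even d)"
proof safe
  fix k d :: nat assume "d dvd 2 ^ k" "odd d"
  then have "coprime d (2 ^ k)" by simp
  then show "d = 1" using coprime_absorb_left[OF \<open>d dvd 2 ^ k\<close>] by simp
next
  assume *: "\<forall>d. d dvd v \<longrightarrow> d = 1 \<or> even d"
  obtain y where y: "v = 2 ^ multiplicity 2 v * y" "odd y"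
    using multiplicity_decompose'[of v 2] assms by auto
  then have "y = 1" using * by (metis dvd_triv_right)
  with y show "\<exists>k. v = 2 ^ k" by auto
qed

text \<open>The bound v^2 < p makes products of factors up to \<open>v\<close> exact, and 2v < p
  does the same for f + f; what remains is the divisor criterion of
  \<open>power_of_two_iff\<close>.\<close>

lemma pow2_in_iff:
  assumes v: "1 < v" and p: "v * v < p"
  shows "pow2_in p v \<longleftrightarrow> (\<exists>k. v = 2 ^ k)"
proof -
  have "2 * v \<le> v * v" using v by (intro mult_right_mono) auto
  with p have p2: "2 * v < p" by simp
  have "pow2_in p v \<longleftrightarrow> (\<forall>d. 0 \<le> d \<and> d dvd v \<longrightarrow> d = 1 \<or> even d)"
  proof
    assume *: "pow2_in p v"
    show "\<forall>d. 0 \<le> d \<and> d dvd v \<longrightarrow> d = 1 \<or> even d"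
    proof (intro allI impI)
      fix d assume d: "0 \<le> d \<and> d dvd v"
      then obtain e where e: "v = d * e" by auto
      have d0: "d > 0" using d e v by (cases "d = 0") auto
      have e0: "e > 0" using d0 e v zero_less_mult_pos[of d e] by simp
      have "d \<le> v" "e \<le> v"
        using e d0 e0 v by (auto intro!: zdvd_imp_le)
      with * have "d = 1 \<or> (\<exists>f\<in>{0..p-1}. f < d \<and> (f + f) mod p = d)"
        using *[unfolded pow2_in_def, rule_format, of d e] d0 e0 e v p2 by simp
      then show "d = 1 \<or> even d"
      proof (elim disjE bexE)
        fix f assume "f \<in> {0..p-1}" "f < d \<and> (f + f) mod p = d"
        moreover from this have "(f + f) mod p = f + f"
          using \<open>d \<le> v\<close> p2 by (intro mod_pos_pos_trivial) auto
        ultimately show ?thesis by presburger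
      qed simp
    qed
  next
    assume *: "\<forall>d. 0 \<le> d \<and> d dvd v \<longrightarrow> d = 1 \<or> even d"
    show "pow2_in p v"
      unfolding pow2_in_def
    proof (intro ballI impI)
      fix d e assume de: "d \<in> {0..p-1}" "e \<in> {0..p-1}" "d \<le> v \<and> e \<le> v \<and> d * e mod p = v"
      have "d * e \<le> v * v" using de v by (intro mult_mono) auto
      then have eq: "d * e = v" using de p by simp
      then have "d > 0" using de v by (cases "d = 0") auto
      have "d = 1 \<or> even d" using *[rule_format, of d] dvd_triv_left[of d e] eq \<open>d > 0\<close> by simp
      then show "d = 1 \<or> (\<exists>f\<in>{0..p-1}. f < d \<and> (f + f) mod p = d)"
      proof
        assume "even d"
        then obtain f where "d = f + f" by (metis evenE mult_2)
        then have "f \<in> {0..p-1} \<and> f < d \<and> (f + f) mod p = d"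
          using \<open>d > 0\<close> de by auto
        then show ?thesis by blast
      qed simp
    qed
  qed
  also have "\<dots> \<longleftrightarrow> (\<forall>d. d dvd nat v \<longrightarrow> d = 1 \<or> even d)"
  proof safe
    fix d :: nat assume *: "\<forall>d. 0 \<le> d \<and> d dvd v \<longrightarrow> d = 1 \<or> even d" "d dvd nat v" "odd d"
    then have "int d dvd v" using v by (auto simp: nat_dvd_iff int_dvd_int_iff dest: iffD2[OF int_dvd_int_iff])
    with * show "d = 1" by (auto dest!: spec[of _ "int d"])
  next
    fix d :: int assume *: "\<forall>d. d dvd nat v \<longrightarrow> d = 1 \<or> even d" "0 \<le> d" "d dvd v" "odd d"
    then have "nat d dvd nat v" using v by (simp add: nat_dvd_iff)
    with * have "nat d = 1 \<or> even (nat d)" by blast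
    with * show "d = 1" by (auto simp: even_nat_iff)
  qed
  also have "\<dots> \<longleftrightarrow> (\<exists>k. nat v = 2 ^ k)" using power_of_two_iff[of "nat v"] v by simp
  also have "\<dots> \<longleftrightarrow> (\<exists>k. v = 2 ^ k)"
    using v by (auto simp: nat_eq_iff)
  finally show ?thesis .
qed

text \<open>Modulo 2^a - 1 the power 2^a is 1, so 2^b - 1 is congruent to 2^(b mod a) - 1, which is
  nonnegative and below 2^a - 1, hence divisible only if it is 0.\<close>

lemma mersenne_dvd_iff:
  assumes "a > 0"
  shows "(2 ^ a - 1 :: int) dvd 2 ^ b - 1 \<longleftrightarrow> a dvd b"
proof -
  have eq: "(2::int) ^ b - 1 = 2 ^ (b mod a) * ((2 ^ a) ^ (b div a) - 1) + (2 ^ (b mod a) - 1)"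
    by (simp add: algebra_simps flip: power_mult power_add)
  have "(2 ^ a - 1 :: int) dvd (2 ^ a) ^ (b div a) - 1"
    by (simp add: power_diff_1_eq)
  then have "(2 ^ a - 1 :: int) dvd 2 ^ b - 1 \<longleftrightarrow> (2 ^ a - 1 :: int) dvd 2 ^ (b mod a) - 1"
    unfolding eq by (simp add: dvd_add_right_iff)
  also have "\<dots> \<longleftrightarrow> b mod a = 0"
  proof
    assume *: "(2 ^ a - 1 :: int) dvd 2 ^ (b mod a) - 1"
    have "(2::int) ^ (b mod a) < 2 ^ a" using assms by (intro power_strict_increasing) auto
    with * have "(2::int) ^ (b mod a) - 1 = 0"
      by (metis diff_strict_right_mono not_less zdvd_imp_le zero_less_diff one_le_power
          one_le_numeral linorder_neqE_linordered_idom less_iff_diff_less_0)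
    then show "b mod a = 0" by simp
  qed auto
  finally show ?thesis by (simp add: dvd_eq_mod_eq_0)
qed

text \<open>As x^4 dominates x^2 + x + 1, the relevant products and sums stay below
  \<open>p\<close>. With x = 2^b the tested v are the powers 2^d with d dvd b, and
  \<open>power_of_two_iff\<close> is then applied to b itself.\<close>

lemma tower_in_iff:
  assumes x: "1 < x" and p: "x ^ 4 < p"
  shows "tower_in p x \<longleftrightarrow> (\<exists>k. x = 2 ^ 2 ^ k)"
proof -
  have xx: "x * x + x + 1 \<le> x ^ 4"
  proof -
    have "2 * x \<le> x * x" using x by (intro mult_right_mono) auto
    moreover have "4 * (x * x) \<le> (x * x) * (x * x)" using mult_mono[of 2 x 2 x] x
      by (intro mult_right_mono) auto
    moreover have "x ^ 4 = (x * x) * (x * x)" by (simp add: power4_eq_xxxx)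
    ultimately show ?thesis using x by linarith
  qed
  have sq: "v * v < p" if "1 < v" "v \<le> x" for v
    using mult_mono[of v x v x] that xx p x by linarith
  have "2 * x \<le> x * x" using x by (intro mult_right_mono) auto
  then have x2: "2 * x + 1 < p" using xx p x by linarith
  have dvd: "(\<exists>w\<in>{0..p-1}. w < x \<and> ((v * w mod p) + 1) mod p = (x + w) mod p) \<longleftrightarrow> (v - 1) dvd (x - 1)"
    if v: "1 < v" "v \<le> x" for v
  proof -
    have 1: "((v * w mod p) + 1) mod p = (x + w) mod p \<longleftrightarrow> x - 1 = (v - 1) * w"
      if "0 \<le> w" "w < x" for w
    proof -
      have "v * w \<le> x * x" using v that by (intro mult_mono) auto
      then have "((v * w mod p) + 1) mod p = v * w + 1"
        using that v xx p x by simp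
      moreover have "(x + w) mod p = x + w" using that v x2 by simp
      ultimately show ?thesis by (auto simp: algebra_simps)
    qed
    \<comment> \<open>The quotient of x - 1 by v - 1 satisfies the bound w < x of the formula
      automatically.\<close>
    have 2: "0 \<le> w \<and> w < x" if "x - 1 = (v - 1) * w" for w
    proof -
      have "w > 0" using that v x zero_less_mult_pos[of "v - 1" w] by simp
      moreover have "1 * w \<le> (v - 1) * w" using calculation v by (intro mult_right_mono) auto
      ultimately show ?thesis using that by linarith
    qed
    have "w \<in> {0..p-1} \<and> w < x \<and> ((v * w mod p) + 1) mod p = (x + w) mod p \<longleftrightarrow> x - 1 = (v - 1) * w"
      for w using 1[of w] 2[of w] x2 x by auto
    then show ?thesis unfolding dvd_def Bex_def by simp
  qed
  have "tower_in p x \<longleftrightarrow> pow2_in p x \<and> (\<forall>v. 1 < v \<and> v \<le> x \<and> pow2_in p v \<and> (v - 1) dvd (x - 1) \<longrightarrow>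
     v = 2 \<or> (\<exists>w\<ge>0. w < v \<and> w * w = v))"
  proof -
    have 1: "(\<exists>w\<in>{0..p-1}. w < v \<and> w * w mod p = v) \<longleftrightarrow> (\<exists>w\<ge>0. w < v \<and> w * w = v)"
      if v: "1 < v" "v \<le> x" for v
    proof -
      have "w * w mod p = w * w \<and> w \<in> {0..p-1}" if "0 \<le> w" "w < v" for w
      proof -
        have "w * w \<le> v * v" using that by (intro mult_mono) auto
        then have "w * w < p" using sq[OF v] by (rule order.strict_trans1)
        then show ?thesis using that v x2 x by simp
      qed
      then have "w \<in> {0..p-1} \<and> w < v \<and> w * w mod p = v \<longleftrightarrow> 0 \<le> w \<and> w < v \<and> w * w = v" for w
        by (metis atLeastAtMost_iff)
      then show ?thesis unfolding Bex_def by simp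
    qed
    have 2: "(1 + 1) mod p = 2" using x x2 by simp
    have mem: "v \<in> {0..p-1}" if "1 < v" "v \<le> x" for v using that x2 x by auto
    have cong: "(\<forall>v\<in>I. 1 < v \<and> v \<le> x \<and> P v \<and> A v \<longrightarrow> v = 2 \<or> B v) \<longleftrightarrow>
        (\<forall>v. 1 < v \<and> v \<le> x \<and> P v \<and> A' v \<longrightarrow> v = 2 \<or> B' v)"
      if "\<And>v. 1 < v \<Longrightarrow> v \<le> x \<Longrightarrow> v \<in> I" "\<And>v. 1 < v \<Longrightarrow> v \<le> x \<Longrightarrow> A v = A' v"
        "\<And>v. 1 < v \<Longrightarrow> v \<le> x \<Longrightarrow> B v = B' v" for I P A A' B B'
      using that by blast
    show ?thesis
      unfolding tower_in_def 2 by (rule conj_cong[OF refl cong[OF mem dvd 1]])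
  qed
  also have "\<dots> \<longleftrightarrow> (\<exists>b. x = 2 ^ b) \<and> (\<forall>v. 1 < v \<and> v \<le> x \<and> (\<exists>a. v = 2 ^ a) \<and> (v - 1) dvd (x - 1) \<longrightarrow>
     v = 2 \<or> (\<exists>w\<ge>0. w < v \<and> w * w = v))"
    using pow2_in_iff sq x by (metis order.refl)
  also have "\<dots> \<longleftrightarrow> (\<exists>k. x = 2 ^ 2 ^ k)"
  proof safe
    fix b
    assume *: "\<forall>v. 1 < v \<and> v \<le> 2 ^ b \<and> (\<exists>a. v = 2 ^ a) \<and> (v - 1) dvd (2 ^ b - 1) \<longrightarrow>
      v = (2::int) \<or> (\<exists>w\<ge>0. w < v \<and> w * w = v)" and xb: "x = 2 ^ b"
    have b: "b > 0" using x xb by (cases b) auto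
    have "d = 1 \<or> even d" if "d dvd b" for d
    proof -
      have d: "d > 0" "d \<le> b" using b that by (auto intro: dvd_imp_le Nat.gr0I)
      have "(2::int) ^ d = 2 \<or> (\<exists>w\<ge>0. w < (2::int) ^ d \<and> w * w = 2 ^ d)"
        using *[rule_format, of "2 ^ d"] d that mersenne_dvd_iff[of d b] by auto
      then show ?thesis
      proof (elim disjE exE conjE)
        assume "(2::int) ^ d = 2"
        then have "d = 1" using power_inject_exp[of "2::int" d 1] by simp
        then show ?thesis ..
      next
        fix w :: int assume w: "0 \<le> w" "w * w = 2 ^ d"
        then have "w \<noteq> 0" by auto
        \<comment> \<open>The exponent of 2 in a square is even.\<close>
        have "multiplicity 2 (w * w) = d" using w by simp
        then have "even d" using \<open>w \<noteq> 0\<close>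
          by (subst (asm) prime_elem_multiplicity_mult_distrib) auto
        then show ?thesis ..
      qed
    qed
    then have "\<exists>k. b = 2 ^ k" using power_of_two_iff[OF b] by auto
    then show "\<exists>k. (2::int) ^ b = 2 ^ 2 ^ k" by auto
  next
    fix k a assume a: "1 < (2::int) ^ a" "(2::int) ^ a - 1 dvd 2 ^ 2 ^ k - 1"
      "\<not> (\<exists>w\<ge>0. w < (2::int) ^ a \<and> w * w = 2 ^ a)"
    have "a > 0" using a by (cases a) auto
    then have "a dvd 2 ^ k" using a mersenne_dvd_iff by blast
    then have "a = 1 \<or> even a" using power_of_two_iff[of "2 ^ k"] by auto
    moreover have "odd a"
    proof
      assume "even a"
      then obtain c where "a = c + c" by (metis evenE mult_2)
      then have "(2::int) ^ c \<ge> 0 \<and> (2::int) ^ c < 2 ^ a \<and> (2::int) ^ c * 2 ^ c = 2 ^ a"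
        using \<open>a > 0\<close> by (auto simp: power_add intro!: power_strict_increasing)
      with a show False by blast
    qed
    ultimately show "(2::int) ^ a = 2" by simp
  qed auto
  finally show ?thesis .
qed

text \<open>The conjuncts are used in order: \<open>small\<close> at x gives x^2 < p, so x^2 is
  represented faithfully; \<open>small\<close> at x^2 gives x^4 < p, so x^3 is too; failure at x^3
  then means p \<le> x^6.\<close>

lemma Z_models_window_sentence:
  assumes "m \<ge> 2"
  shows "Z_models m window_sentence \<longleftrightarrow> (\<exists>k. (2 ^ 2 ^ k) ^ 4 < m \<and> m \<le> (2 ^ 2 ^ k) ^ 6)"
proof -
  define p where "p = int m"
  have p: "p \<ge> 2" using assms by (simp add: p_def)
  have "(x \<in> {0..p-1} \<and> 1 < x \<and> small p x \<and>
     small p (x * x mod p) \<and> \<not> small p ((x * x mod p) * x mod p) \<and> tower_in p x) \<longleftrightarrow>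
     1 < x \<and> x ^ 4 < p \<and> p \<le> x ^ 6 \<and> (\<exists>k. x = 2 ^ 2 ^ k)" for x
  proof (cases "1 < x")
    case True
    have mono: "x ^ i \<le> x ^ j" if "i \<le> j" for i j :: nat using True that by (intro power_increasing) auto
    have x4: "x < p" "x * x < p" "x ^ 3 < p" if "x ^ 4 < p"
      using that mono[of 1 4] mono[of 2 4] mono[of 3 4] by (auto simp: power2_eq_square)
    have "x ^ 4 < p" if "x \<in> {0..p-1}" "small p x" "small p (x * x mod p)"
    proof -
      have "x * x < p" using small_iff[of p x] that p by auto
      then show ?thesis using small_iff[of p "x * x"] that p True by (simp add: power4_eq_xxxx algebra_simps)
    qed
    moreover have "x \<in> {0..p-1} \<and> small p x \<and> small p (x * x mod p)" if "x ^ 4 < p"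
      using small_iff[of p "x * x"] small_iff[of p x] x4[OF that] that p True
      by (simp add: power4_eq_xxxx algebra_simps)
    moreover have "small p ((x * x mod p) * x mod p) \<longleftrightarrow> x ^ 6 < p" if "x ^ 4 < p"
    proof -
      have "(x * x mod p) * x mod p = x ^ 3"
        using x4[OF that] True by (simp add: power3_eq_cube)
      then show ?thesis using small_iff[of p "x ^ 3"] x4[OF that] p True
        by (simp flip: power_add)
    qed
    ultimately show ?thesis using True tower_in_iff[of x p] by (auto simp: not_less)
  qed auto
  then have "sat m e window_sentence \<longleftrightarrow>
     (\<exists>x. 1 < x \<and> x ^ 4 < p \<and> p \<le> x ^ 6 \<and> (\<exists>k. x = 2 ^ 2 ^ k))" for e
    unfolding sat_window_sentence[OF assms, folded p_def] by (simp add: Bex_def)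
  also have "\<dots> \<longleftrightarrow> (\<exists>k. (2 ^ 2 ^ k) ^ 4 < p \<and> p \<le> (2 ^ 2 ^ k) ^ 6)"
    using one_less_power[of "2::int" "2 ^ _"] by fastforce
  also have "\<dots> \<longleftrightarrow> (\<exists>k. (2 ^ 2 ^ k) ^ 4 < m \<and> m \<le> (2 ^ 2 ^ k) ^ 6)"
    unfolding p_def by (metis of_nat_less_iff of_nat_le_iff of_nat_power of_nat_numeral)
  finally have *: "sat m e window_sentence \<longleftrightarrow> (\<exists>k. (2 ^ 2 ^ k) ^ 4 < m \<and> m \<le> (2 ^ 2 ^ k) ^ 6)" for e .
  \<comment> \<open>Some assignment into the carrier exists, so the quantifier in
    \<open>Z_models\<close> is not vacuous.\<close>
  have "range (\<lambda>_::nat. 0) \<subseteq> carrier (residue_ring (int m))"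
    using assms by (auto simp: residue_ring_def)
  then show ?thesis unfolding Z_models_def * by blast
qed

section \<open>A Chebyshev-type lower bound for the prime count\<close>

text \<open>
  The numbers \<open>1 / ((n + 1) * (n choose k))\<close> form Leibniz's harmonic triangle: each entry in column
  \<open>k + 1\<close> is a difference of two entries in column \<open>k\<close>. Hence any common multiple of \<open>1, \<dots>, N\<close>
  is a multiple of all the denominators in the first \<open>N\<close> rows.
\<close>

lemma binomial_dvd:
  assumes "\<And>i. 1 \<le> i \<Longrightarrow> i \<le> N \<Longrightarrow> int i dvd D" "k \<le> n" "n < N"
  shows "int (Suc n * (n choose k)) dvd D"
  using assms(2,3)
proof (induction k arbitrary: n)
  case 0
  then show ?case using assms(1)[of "Suc n"] by simp
next
  case (Suc k)
  then obtain m where n: "n = Suc m" by (cases n) auto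
  \<comment> \<open>\<open>y\<close> and \<open>z\<close> are \<open>D\<close> times the entries of
    column k in rows n and n - 1; z - y will be the quotient for column k + 1.\<close>
  obtain y where y: "D = int (Suc n * (n choose k)) * y"
    using Suc.IH[of n] Suc.prems by (metis Suc_leD dvdE)
  obtain z where z: "D = int (Suc m * (m choose k)) * z"
    using Suc.IH[of m] Suc.prems n by (metis Suc_le_mono Suc_lessD dvdE)
  define A where "A = int (n choose Suc k)"
  define B where "B = int (n choose k)"
  define C where "C = int (m choose k)"
  have 1: "A * int (Suc k) = int n * C"
    using Suc_times_binomial[of k m] n by (metis A_def C_def of_nat_mult mult.commute)
  have 2: "B * (int n - int k) = int n * C"
  proof -
    have "int ((n - k) * (n choose k)) = int (n * (m choose k))"
      using binomial_absorb_comp[of n k] n by simp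
    then show ?thesis using Suc.prems by (simp add: B_def C_def mult.commute of_nat_diff)
  qed
  have D1: "D = (int n + 1) * B * y" using y B_def by (simp add: algebra_simps)
  have D2: "D = int n * C * z" using z n C_def by (simp add: algebra_simps)
  \<comment> \<open>Writing k + 1 = (n + 1) - (n - k) brings in both absorption identities; the
    factor k + 1 cancels at the end.\<close>
  have "D * int (Suc k) = D * (int n + 1) - D * (int n - int k)" by (simp add: algebra_simps)
  also have "D * (int n + 1) = (int n + 1) * (int n * C) * z" using D2 by (simp add: algebra_simps)
  also have "D * (int n - int k) = (int n + 1) * (B * (int n - int k)) * y" using D1 by (simp add: algebra_simps)
  also have "\<dots> = (int n + 1) * (int n * C) * y" unfolding 2 ..
  also have "(int n + 1) * (int n * C) * z - (int n + 1) * (int n * C) * y = (int n + 1) * (int n * C) * (z - y)"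
    by (simp add: algebra_simps)
  also have "\<dots> = ((int n + 1) * A * (z - y)) * int (Suc k)" unfolding 1[symmetric] by (simp add: algebra_simps)
  finally have "D = (int n + 1) * A * (z - y)" by (metis mult_right_cancel of_nat_eq_0_iff nat.distinct(1))
  then have "D = int (Suc n * (n choose Suc k)) * (z - y)" by (simp add: A_def algebra_simps)
  then show ?case by (rule dvdI)
qed

text \<open>\<open>D\<close> is the least common multiple of 1, ..., N. Each prime contributes a
  power at most \<open>N\<close>, which bounds \<open>D\<close> above; each N * ((N - 1) choose k)
  divides \<open>D\<close>, and summing over the N values of k gives 2^(N - 1) \<le> D.\<close>

lemma two_power_le_power_card_primes:
  assumes "N > 0"
  shows "2 ^ (N - 1) \<le> N ^ card {p. prime p \<and> p \<le> N}"
proof -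
  define P where "P = {p. prime p \<and> p \<le> N}"
  have fin: "finite P" unfolding P_def by (rule finite_subset[of _ "{..N}"]) auto
  have "\<exists>a. p ^ a \<le> N \<and> N < p ^ (a + 1)" if "p \<in> P" for p
    using ex_power_ivl1[of p N] that assms by (auto simp: P_def dest: prime_ge_2_nat)
  then obtain a where a: "\<And>p. p \<in> P \<Longrightarrow> p ^ a p \<le> N \<and> N < p ^ (a p + 1)" by metis
  define D where "D = (\<Prod>p\<in>P. p ^ a p)"
  have "D \<le> (\<Prod>p\<in>P. N)" unfolding D_def using a by (intro prod_mono) auto
  then have DN: "D \<le> N ^ card P" by simp
  have "D > 0" unfolding D_def by (intro prod_pos) (auto simp: P_def prime_gt_0_nat)
  have dvd: "int i dvd int D" if i: "1 \<le> i" "i \<le> N" for i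
  proof -
    have "i = (\<Prod>p\<in>prime_factors i. p ^ multiplicity p i)"
      using prime_factorization_nat[of i] i by simp
    also have "\<dots> dvd (\<Prod>p\<in>prime_factors i. p ^ a p)"
    proof (intro prod_dvd_prod le_imp_power_dvd)
      fix p assume p: "p \<in> prime_factors i"
      then have "p \<in> P" using i by (auto simp: P_def prime_factors_dvd dest!: dvd_imp_le)
      have "p ^ multiplicity p i \<le> i" using i by (intro dvd_imp_le multiplicity_dvd) auto
      also have "\<dots> < p ^ (a p + 1)" using a[OF \<open>p \<in> P\<close>] i by auto
      finally have "multiplicity p i < a p + 1"
        using \<open>p \<in> P\<close> by (subst (asm) power_strict_increasing_iff) (auto simp: P_def dest: prime_gt_1_nat)
      then show "multiplicity p i \<le> a p" by simp
    qed
    also have "\<dots> dvd D" unfolding D_def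
      using i fin by (intro prod_dvd_prod_subset) (auto simp: P_def prime_factors_dvd dest!: dvd_imp_le)
    finally show ?thesis by simp
  qed
  have le: "N * ((N - 1) choose k) \<le> D" if "k \<le> N - 1" for k
    using binomial_dvd[of N "int D" k "N - 1"] dvd that assms \<open>D > 0\<close>
    by (simp del: of_nat_mult add: dvd_imp_le)
  have "N * 2 ^ (N - 1) = (\<Sum>k\<le>N - 1. N * ((N - 1) choose k))"
    by (simp add: choose_row_sum flip: sum_distrib_left)
  also have "\<dots> \<le> (\<Sum>k\<le>N - 1. D)" using le by (intro sum_mono) auto
  also have "\<dots> = N * D" using assms by simp
  finally show ?thesis using DN assms by (simp add: P_def)
qed

text \<open>For N = 2^m both sides of \<open>two_power_le_power_card_primes\<close> are powers of
  two, so exponents can be compared.\<close>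

lemma prime_pi_two_power: "2 ^ m \<le> m * prime_pi (2 ^ m) + 1"
proof -
  have "prime_pi (2 ^ m) = card {p::nat. prime p \<and> p \<le> 2 ^ m}"
  proof -
    have "real q \<le> 2 ^ m \<longleftrightarrow> q \<le> 2 ^ m" for q :: nat
      by (metis of_nat_le_iff of_nat_numeral of_nat_power)
    then show ?thesis by (simp add: prime_pi_def count_upto_def)
  qed
  then have "(2::nat) ^ (2 ^ m - 1) \<le> 2 ^ (m * prime_pi (2 ^ m))"
    using two_power_le_power_card_primes[of "2 ^ m"] by (simp add: power_mult)
  then have "2 ^ m - 1 \<le> m * prime_pi (2 ^ m)" by (subst (asm) power_increasing_iff) auto
  then show ?thesis by simp
qed

lemma prime_pi_two_power_real:
  assumes "m > 0"
  shows "(2 ^ m - 1) / real m \<le> real (prime_pi (2 ^ m))"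
proof -
  have "real (2 ^ m) \<le> real (m * prime_pi (2 ^ m) + 1)"
    using prime_pi_two_power[of m] by (subst of_nat_le_iff)
  then show ?thesis using assms by (simp add: field_simps)
qed

section \<open>Counting window primes and the density ratio\<close>

lemma card_le_of_subset:
  fixes A :: "nat set"
  assumes "A \<subseteq> {1..n}"
  shows "card A \<le> n"
  using card_mono[OF _ assms] by simp

lemma finite_count: "finite {q \<in> S. real q \<le> real n}"
  by (rule finite_subset[of _ "{..n}"]) auto

lemma count_upto_mono: "S \<subseteq> T \<Longrightarrow> count_upto S (real n) \<le> count_upto T (real n)"
  unfolding count_upto_def by (rule card_mono[OF finite_count]) auto

lemma ln_ratio_mono:
  fixes a b p q :: real
  assumes "1 \<le> a" "a \<le> b" "1 < p" "p \<le> q"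
  shows "ln a / ln q \<le> ln b / ln p"
  using assms by (intro frac_le) auto

lemma prime_pi_le: "prime_pi (real n) \<le> n"
  unfolding prime_pi_def count_upto_def
  by (rule card_le_of_subset) (auto simp: Suc_le_eq prime_gt_0_nat)

text \<open>With \<open>X = 2 ^ 2 ^ k\<close>, the window \<open>(X\<^sup>4, X\<^sup>6]\<close> is followed by the gap \<open>(X\<^sup>6, X\<^sup>8]\<close>, since the
  next window begins at \<open>(X\<^sup>2)\<^sup>4\<close>.\<close>

definition window_primes :: "nat set" where
  "window_primes = {p. prime p \<and> (\<exists>k. (2 ^ 2 ^ k) ^ 4 < p \<and> p \<le> (2 ^ 2 ^ k) ^ 6)}"

text \<open>With X = 2^m, a prime up to X^6 lies in the window or is at most X^4; the latter are
  counted trivially.\<close>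

lemma count_window_ge:
  assumes "m = 2 ^ k"
  shows "prime_pi (real (2 ^ (6 * m))) \<le> count_upto window_primes (real (2 ^ (6 * m))) + 2 ^ (4 * m)"
proof -
  let ?W = "{q \<in> window_primes. real q \<le> real (2 ^ (6 * m))}"
  have "{q \<in> {p. prime p}. real q \<le> real (2 ^ (6 * m))} \<subseteq> ?W \<union> {1..2 ^ (4 * m)}"
  proof
    fix q assume "q \<in> {q \<in> {p. prime p}. real q \<le> real (2 ^ (6 * m))}"
    then have q: "prime q" "q \<le> 2 ^ (6 * m)" using of_nat_le_iff by blast+
    then show "q \<in> ?W \<union> {1..2 ^ (4 * m)}"
      unfolding window_primes_def using prime_gt_0_nat[of q] assms
      by (auto simp: not_less mult.commute simp flip: power_mult simp del: of_nat_power
           intro!: exI[of _ k])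
  qed
  then have "prime_pi (real (2 ^ (6 * m))) \<le> card (?W \<union> {1..2 ^ (4 * m)})"
    unfolding prime_pi_def count_upto_def by (rule card_mono[rotated]) (intro finite_UnI finite_count finite_atLeastAtMost)
  also have "\<dots> \<le> card ?W + card {1..(2::nat) ^ (4 * m)}" by (rule card_Un_le)
  finally show ?thesis unfolding count_upto_def by simp
qed

text \<open>Windows of index above k start beyond X^8, so every prime counted is at most
  X^6.\<close>

lemma count_window_le:
  assumes "m = 2 ^ k"
  shows "count_upto window_primes (real (2 ^ (8 * m))) \<le> 2 ^ (6 * m)"
  unfolding count_upto_def
proof (rule card_le_of_subset, rule subsetI)
  fix q assume "q \<in> {q \<in> window_primes. real q \<le> real (2 ^ (8 * m))}"
  then have q8: "q \<le> 2 ^ (8 * m)" and "q \<in> window_primes" using of_nat_le_iff by blast+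
  then obtain j where q: "prime q" "(2 ^ 2 ^ j) ^ 4 < q" "q \<le> (2 ^ 2 ^ j) ^ 6"
    by (auto simp: window_primes_def)
  have "j \<le> k"
  proof (rule ccontr)
    assume "\<not> j \<le> k"
    then have "(2::nat) ^ Suc k \<le> 2 ^ j" by (intro power_increasing) auto
    then have "8 * m \<le> 2 ^ j * 4" using assms by simp
    then have "(2::nat) ^ (8 * m) \<le> 2 ^ (2 ^ j * 4)" by (intro power_increasing) auto
    with q q8 show False by (simp flip: power_mult)
  qed
  then have "(2::nat) ^ j \<le> 2 ^ k" by (intro power_increasing) auto
  then have "2 ^ j * 6 \<le> 6 * m" using assms by simp
  then have "(2::nat) ^ (2 ^ j * 6) \<le> 2 ^ (6 * m)" by (intro power_increasing) auto
  moreover have "q \<le> 2 ^ (2 ^ j * 6)" using q(3) by (simp add: power_mult)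
  ultimately have "q \<le> 2 ^ (6 * m)" by (rule order.trans[rotated])
  then show "q \<in> {1..2 ^ (6 * m)}" using prime_gt_0_nat[OF q(1)] by simp
qed

lemma filterlim_two_power: "filterlim (\<lambda>k. 2 ^ k :: nat) at_top sequentially"
  by (rule filterlim_subseq) (auto intro: strict_monoI)

lemma not_has_exponential_density_window: "\<not> has_exponential_density window_primes"
proof
  assume "has_exponential_density window_primes"
  then obtain L where L: "(\<lambda>n::nat. ln (real (count_upto window_primes (real n))) /
      ln (real (prime_pi (real n)))) \<longlonglongrightarrow> L" (is "?f \<longlonglongrightarrow> L")
    unfolding has_exponential_density_def by blast
  \<comment> \<open>The subsequences n = X^6 and n = X^8 with X = 2^(2^k) are taken with c = 6 and c
    = 8.\<close>
  have lim: "(\<lambda>k. ?f (2 ^ (c * 2 ^ k))) \<longlonglongrightarrow> L" if "c > 0" for c :: nat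
  proof (rule filterlim_compose[OF L])
    show "filterlim (\<lambda>k. 2 ^ (c * 2 ^ k) :: nat) at_top sequentially"
      by (rule filterlim_subseq) (use that in \<open>auto intro!: strict_monoI\<close>)
  qed
  \<comment> \<open>\<open>lo\<close> bounds the window count up to X^6 from below,
    \<open>lo8\<close> the prime count up to X^8. Asymptotics are proved in m and then composed with
    m = 2^k.\<close>
  define lo where "lo m = (2 ^ (6 * m) - 1) / real (6 * m) - 2 ^ (4 * m)" for m
  define lo8 where "lo8 m = (2 ^ (8 * m) - 1) / real (8 * m)" for m
  have "eventually (\<lambda>m. lo m \<ge> 1) at_top" unfolding lo_def by real_asymp
  then have ev1: "eventually (\<lambda>k. lo (2 ^ k) \<ge> 1) sequentially"
    using filterlim_two_power by (rule eventually_compose_filterlim)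
  have "eventually (\<lambda>m. lo8 m > 1) at_top" unfolding lo8_def by real_asymp
  then have ev2: "eventually (\<lambda>k. lo8 (2 ^ k) > 1) sequentially"
    using filterlim_two_power by (rule eventually_compose_filterlim)
  have "(\<lambda>m. ln (lo m) / ln (2 ^ (6 * m))) \<longlonglongrightarrow> 1" unfolding lo_def by real_asymp
  then have l1: "(\<lambda>k. ln (lo (2 ^ k)) / ln (2 ^ (6 * 2 ^ k))) \<longlonglongrightarrow> 1"
    using filterlim_two_power by (rule filterlim_compose)
  have "(\<lambda>m. ln (2 ^ (6 * m)) / ln (lo8 m)) \<longlonglongrightarrow> 3 / 4" unfolding lo8_def by real_asymp
  then have l2: "(\<lambda>k. ln (2 ^ (6 * 2 ^ k)) / ln (lo8 (2 ^ k))) \<longlonglongrightarrow> 3 / 4"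
    using filterlim_two_power by (rule filterlim_compose)
  have "1 \<le> L"
  proof (rule tendsto_le[OF _ lim[of 6] l1])
    show "eventually (\<lambda>k. ln (lo (2 ^ k)) / ln (2 ^ (6 * 2 ^ k)) \<le> ?f (2 ^ (6 * 2 ^ k))) sequentially"
      using ev1
    proof eventually_elim
      case (elim k)
      define m :: nat where "m = 2 ^ k"
      let ?c = "count_upto window_primes (real (2 ^ (6 * m)))"
      let ?p = "prime_pi (real (2 ^ (6 * m)))"
      have "real ?p \<le> real (?c + 2 ^ (4 * m))"
        using count_window_ge[OF m_def] by (rule of_nat_mono)
      then have p: "real ?p \<le> real ?c + 2 ^ (4 * m)" by simp
      have lo: "lo m + 2 ^ (4 * m) \<le> real ?p" "1 \<le> lo m"
        using prime_pi_two_power_real[of "6 * m"] elim by (simp_all add: lo_def m_def)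
      have "ln (lo m) / ln (real (2 ^ (6 * m))) \<le> ln (real ?c) / ln (real ?p)"
      proof (rule ln_ratio_mono)
        show "lo m \<le> real ?c" using p lo(1) by linarith
        show "1 < real ?p" using lo one_le_power[of "2::real" "4 * m"] by linarith
        show "real ?p \<le> real (2 ^ (6 * m))" by (rule of_nat_mono[OF prime_pi_le])
      qed (fact lo(2))
      then show ?case by (simp add: m_def)
    qed
  qed auto
  moreover have "L \<le> 3 / 4"
  proof (rule tendsto_le[OF _ l2 lim[of 8]])
    show "eventually (\<lambda>k. ?f (2 ^ (8 * 2 ^ k)) \<le> ln (2 ^ (6 * 2 ^ k)) / ln (lo8 (2 ^ k))) sequentially"
      using ev2
    proof eventually_elim
      case (elim k)
      define m :: nat where "m = 2 ^ k"
      let ?c = "count_upto window_primes (real (2 ^ (8 * m)))"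
      let ?p = "prime_pi (real (2 ^ (8 * m)))"
      have c: "real ?c \<le> real (2 ^ (6 * m))"
        using count_window_le[OF m_def] by (rule of_nat_mono)
      have p: "lo8 m \<le> real ?p" "1 < lo8 m"
        using prime_pi_two_power_real[of "8 * m"] elim by (simp_all add: lo8_def m_def)
      have "ln (real ?c) / ln (real ?p) \<le> ln (real (2 ^ (6 * m))) / ln (lo8 m)"
      proof (cases "?c = 0")
        \<comment> \<open>Here \<open>ln 0 = 0\<close> makes the left side 0, while
          \<open>ln_ratio_mono\<close> requires a count of at least 1.\<close>
        case True
        have "0 \<le> ln (real (2 ^ (6 * m))) / ln (lo8 m)"
          using p(2) by (intro divide_nonneg_pos ln_ge_zero) auto
        with True show ?thesis by (simp del: of_nat_power)
      next
        case False
        then have "1 \<le> real ?c" by linarith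
        then show ?thesis using c p(2,1) by (rule ln_ratio_mono)
      qed
      then show ?case by (simp add: m_def)
    qed
  qed auto
  ultimately show False by simp
qed

theorem theorem8p3:
  shows "\<exists>\<theta>. ring_sentence \<theta> \<and> \<not> has_exponential_density (prime_spectrum \<theta>)"
proof -
  have "prime_spectrum window_sentence = window_primes"
    unfolding prime_spectrum_def window_primes_def
    using Z_models_window_sentence prime_ge_2_nat by blast
  then show ?thesis
    using ring_sentence_window not_has_exponential_density_window by metis
qed

end
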